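(* Let $A$ be an arbitrary rank-1 symmetric matrix, which is, without loss of generality, of the form $A:=uu^\top$, where $\mathbf{0}\ne u\in\mathbb{R}^n$. If $i^*:=\arg\max_{i}\{|u_i|\}=\arg\max_{i}\{|a_{ii}|\}$, then $$H:=\frac{1}{u_{i^*}^2}\,e_{i^*}e_{i^*}^\top,$$ where $e_{i^*}\in\mathbb{R}^n$ is a standard unit vector, is a symmetric reflexive generalized inverse of $A$ with minimum 1-norm.
   Context: All matrices are real, and $a_{ij}$ denotes the $(i,j)$ entry of $A$. A generalized inverse of $A\in\mathbb{R}^{m\times n}$ is a matrix $H\in\mathbb{R}^{n\times m}$ with $AHA=A$. It is called reflexive if in addition $HAH=H$, and (when $m=n$) symmetric if $H=H^\top$. The vector $e_i\in\mathbb{R}^n$ is the standard unit vector with a 1 in position $i$ and zeros elsewhere. For a matrix $H$, the 1-norm is $\|H\|_1:=\sum_{i,j}|h_{ij}|$, the vector 1-norm of the entries of $H$ (not the induced operator norm). "With minimum 1-norm" means that $\|H\|_1\le\|G\|_1$ for every symmetric reflexive generalized inverse $G$ of $A$. *)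

theory Defs
  imports "HOL-Analysis.Analysis"
begin

text \<open>An \<open>m \<times> n\<close> real matrix has type \<open>real ^ 'n ^ 'm\<close>.\<close>

definition outer_product :: "real ^ 'm \<Rightarrow> real ^ 'n \<Rightarrow> real ^ 'n ^ 'm" where
  "outer_product x y = (\<chi> i j. x $ i * y $ j)"

definition symmetric_matrix :: "real ^ 'n ^ 'n \<Rightarrow> bool" where
  "symmetric_matrix A \<longleftrightarrow> transpose A = A"

definition generalized_inverse :: "real ^ 'n ^ 'm \<Rightarrow> real ^ 'm ^ 'n \<Rightarrow> bool" where
  "generalized_inverse A H \<longleftrightarrow> A ** H ** A = A"

definition reflexive_generalized_inverse :: "real ^ 'n ^ 'm \<Rightarrow> real ^ 'm ^ 'n \<Rightarrow> bool" where
  "reflexive_generalized_inverse A H \<longleftrightarrow> generalized_inverse A H \<and> H ** A ** H = H"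

definition symmetric_reflexive_generalized_inverse ::
    "real ^ 'n ^ 'n \<Rightarrow> real ^ 'n ^ 'n \<Rightarrow> bool" where
  "symmetric_reflexive_generalized_inverse A H \<longleftrightarrow>
     reflexive_generalized_inverse A H \<and> symmetric_matrix H"

text \<open>The entrywise 1-norm, not the operator norm induced by the vector 1-norm.\<close>

definition norm1 :: "real ^ 'n ^ 'm \<Rightarrow> real" where
  "norm1 H = (\<Sum>i\<in>UNIV. \<Sum>j\<in>UNIV. \<bar>H $ i $ j\<bar>)"

definition min_norm1_symmetric_reflexive_generalized_inverse ::
    "real ^ 'n ^ 'n \<Rightarrow> real ^ 'n ^ 'n \<Rightarrow> bool" where
  "min_norm1_symmetric_reflexive_generalized_inverse A H \<longleftrightarrow>
     symmetric_reflexive_generalized_inverse A H \<and>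
     (\<forall>G. symmetric_reflexive_generalized_inverse A G \<longrightarrow> norm1 H \<le> norm1 G)"

end

theory Submission
  imports Defs
begin

text \<open>For \<open>A = u u\<^sup>T\<close> the condition \<open>A G A = A\<close> says \<open>u\<^sup>T G u = 1\<close>. Bounding each \<open>\<bar>u\<^sub>i u\<^sub>j\<bar>\<close> by
  \<open>u\<^sub>i\<^sub>*\<^sup>2\<close> in this quadratic form gives \<open>1 \<le> u\<^sub>i\<^sub>*\<^sup>2 \<parallel>G\<parallel>\<^sub>1\<close>, and \<open>H\<close> attains equality. A symmetric
  rank-1 matrix \<open>x y\<^sup>T\<close> has \<open>y = c x\<close>, so it is \<open>\<plusminus> v v\<^sup>T\<close> with \<open>v = \<surd>\<bar>c\<bar> x\<close>.\<close>

lemma outer_product_nth [simp]: "outer_product x y $ i $ j = x $ i * y $ j"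
  by (simp add: outer_product_def)

lemma outer_product_mult_matrix:
  "outer_product x y ** G = outer_product x (y v* G)"
  by (simp add: vec_eq_iff matrix_matrix_mult_def vector_matrix_mult_def sum_distrib_left mult_ac)

lemma outer_product_mult_outer_product:
  "outer_product x y ** outer_product z w = outer_product ((y \<bullet> z) *\<^sub>R x) w"
  by (simp add: vec_eq_iff matrix_matrix_mult_def inner_vec_def sum_distrib_left sum_distrib_right mult_ac)

text \<open>Associativity gives \<open>(x y^T) G (x y^T) = (y^T G x) x y^T\<close>. The matrix
  \<open>x y^T\<close> has a nonzero entry, so it is reproduced exactly when the scalar is
  1.\<close>

lemma generalized_inverse_outer_product_iff:
  fixes x :: "real ^ 'm" and y :: "real ^ 'n"
  assumes "x \<noteq> 0" "y \<noteq> 0"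
  shows "generalized_inverse (outer_product x y) G \<longleftrightarrow> (y v* G) \<bullet> x = 1"
proof -
  obtain i j where ij: "x $ i \<noteq> 0" "y $ j \<noteq> 0"
    using assms by (auto simp: vec_eq_iff)
  have "outer_product x y ** G ** outer_product x y = outer_product (((y v* G) \<bullet> x) *\<^sub>R x) y"
    unfolding outer_product_mult_matrix[of x y G] outer_product_mult_outer_product ..
  also have "\<dots> = outer_product x y \<longleftrightarrow> (y v* G) \<bullet> x = 1"
    using ij by (auto simp: vec_eq_iff)
  finally show ?thesis
    by (simp add: generalized_inverse_def)
qed

lemma bilinear_form_le_norm1:
  assumes "\<And>i. \<bar>x $ i\<bar> \<le> a" "\<And>j. \<bar>y $ j\<bar> \<le> b"
  shows "(x v* G) \<bullet> y \<le> a * b * norm1 G"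
proof -
  have "(x v* G) \<bullet> y = (\<Sum>j\<in>UNIV. \<Sum>i\<in>UNIV. G $ i $ j * x $ i * y $ j)"
    by (simp add: inner_vec_def vector_matrix_mult_def sum_distrib_left mult_ac)
  also have "\<dots> = (\<Sum>i\<in>UNIV. \<Sum>j\<in>UNIV. G $ i $ j * x $ i * y $ j)"
    by (rule sum.swap)
  also have "\<dots> \<le> (\<Sum>i\<in>UNIV. \<Sum>j\<in>UNIV. a * b * \<bar>G $ i $ j\<bar>)"
  proof (intro sum_mono)
    fix i j
    \<comment> \<open>The bound \<open>a\<close> dominates an absolute value; its sign is what
      allows the two entry bounds to be multiplied.\<close>
    have "0 \<le> a" using assms(1)[of i] by linarith
    have "G $ i $ j * x $ i * y $ j \<le> \<bar>G $ i $ j * x $ i * y $ j\<bar>" by simp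
    also have "\<dots> = \<bar>x $ i\<bar> * \<bar>y $ j\<bar> * \<bar>G $ i $ j\<bar>" by (simp add: abs_mult mult_ac)
    also have "\<dots> \<le> a * b * \<bar>G $ i $ j\<bar>"
      using assms \<open>0 \<le> a\<close> by (intro mult_right_mono mult_mono) auto
    finally show "G $ i $ j * x $ i * y $ j \<le> a * b * \<bar>G $ i $ j\<bar>" .
  qed
  also have "\<dots> = a * b * norm1 G"
    by (simp add: norm1_def sum_distrib_left)
  finally show ?thesis .
qed

text \<open>Every row is a multiple of \<open>y\<close>, and a row with
  \<open>x $ i \<noteq> 0\<close> recovers \<open>y\<close> by scaling, so the row space is the line
  through \<open>y\<close>.\<close>

lemma rank_outer_product:
  fixes x :: "real ^ 'm" and y :: "real ^ 'n"
  assumes "x \<noteq> 0" "y \<noteq> 0"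
  shows "rank (outer_product x y) = 1"
proof -
  obtain i where i: "x $ i \<noteq> 0"
    using assms by (auto simp: vec_eq_iff)
  have row: "row k (outer_product x y) = x $ k *\<^sub>R y" for k
    by (simp add: row_def vec_eq_iff)
  have "y = (1 / x $ i) *\<^sub>R row i (outer_product x y)"
    using i by (simp add: row)
  moreover have "row i (outer_product x y) \<in> span (rows (outer_product x y))"
    by (rule span_base) (auto simp: rows_def)
  ultimately have "y \<in> span (rows (outer_product x y))"
    by (metis span_mul)
  moreover have "rows (outer_product x y) \<subseteq> span {y}"
    by (auto simp: rows_def row intro: span_mul span_base)
  ultimately have "span (rows (outer_product x y)) = span {y}"
    by (metis empty_subsetI insert_subset span_eq)
  then have "dim (rows (outer_product x y)) = dim {y}"
    by (metis dim_span)
  then show ?thesis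
    using assms by (simp add: row_rank_def)
qed

text \<open>The row space is spanned by a single vector \<open>y\<close>, and the coefficients of
  the rows along \<open>y\<close> form the left factor. A vanishing factor would make
  \<open>B\<close> zero, hence of rank 0.\<close>

lemma rank_1_imp_outer_product:
  fixes B :: "real ^ 'n ^ 'm"
  assumes "rank B = 1"
  obtains x y where "x \<noteq> 0" "y \<noteq> 0" "B = outer_product x y"
proof -
  obtain S where S: "rows B \<subseteq> span S" "card S = 1"
    using assms basis_exists[of "rows B"] by (metis row_rank_def)
  then obtain y where "rows B \<subseteq> span {y}"
    by (metis card_1_singletonE)
  then have "\<exists>c. row i B = c *\<^sub>R y" for i
    by (auto simp: rows_def span_singleton)
  then obtain f where f: "\<And>i. row i B = f i *\<^sub>R y"
    by metis
  have B: "B = outer_product (\<chi> i. f i) y"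
    using f by (simp add: vec_eq_iff row_def)
  have "B \<noteq> 0"
    using assms by auto
  then have "(\<chi> i. f i) \<noteq> 0" "y \<noteq> 0"
    unfolding B by (auto simp: vec_eq_iff)
  with B show thesis
    using that by blast
qed

text \<open>The sign alternative is unavoidable: \<open>v v^T\<close> is positive semidefinite,
  while \<open>B\<close> may be negative semidefinite.\<close>

lemma symmetric_rank_1_cases:
  fixes B :: "real ^ 'n ^ 'n"
  assumes "rank B = 1" "symmetric_matrix B"
  obtains v where "v \<noteq> 0" "B = outer_product v v \<or> - B = outer_product v v"
proof -
  obtain x y where x: "x \<noteq> 0" and y: "y \<noteq> 0" and B: "B = outer_product x y"
    using assms(1) by (rule rank_1_imp_outer_product)
  have sym: "x $ i * y $ j = x $ j * y $ i" for i j
    using assms(2) by (simp add: symmetric_matrix_def vec_eq_iff transpose_def B mult.commute)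
  obtain k where k: "x $ k \<noteq> 0"
    using x by (auto simp: vec_eq_iff)
  \<comment> \<open>If \<open>y $ k\<close> were 0, symmetry would give
    \<open>x $ k * y $ j = 0\<close> for all \<open>j\<close>, hence \<open>y = 0\<close>.\<close>
  have "y $ k \<noteq> 0"
    using y k sym[of k] by (auto simp: vec_eq_iff)
  define c where "c = y $ k / x $ k"
  have c: "c \<noteq> 0"
    using k \<open>y $ k \<noteq> 0\<close> by (simp add: c_def)
  have yc: "y $ j = c * x $ j" for j
    using sym[of k j] k by (simp add: c_def field_simps)
  show thesis
  proof
    show "sqrt \<bar>c\<bar> *\<^sub>R x \<noteq> 0"
      using c x by simp
    \<comment> \<open>Since \<open>B\<close> has entries \<open>c * x $ i * x $ j\<close>, the sign
      of \<open>c\<close> decides which alternative holds.\<close>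
    have "sqrt \<bar>c\<bar> * x $ i * (sqrt \<bar>c\<bar> * x $ j) = \<bar>c\<bar> * (x $ i * x $ j)" for i j
      by (simp add: mult_ac flip: mult.assoc[of "sqrt \<bar>c\<bar>" "sqrt \<bar>c\<bar>"])
    then show "B = outer_product (sqrt \<bar>c\<bar> *\<^sub>R x) (sqrt \<bar>c\<bar> *\<^sub>R x) \<or>
        - B = outer_product (sqrt \<bar>c\<bar> *\<^sub>R x) (sqrt \<bar>c\<bar> *\<^sub>R x)"
      by (cases "c \<ge> 0") (auto simp: vec_eq_iff B yc)
  qed
qed

lemma matrix_mult_minus_left: "(- A) ** B = - (A ** B)"
  for A :: "'a::ring_1 ^ 'n ^ 'm"
  by (simp add: vec_eq_iff matrix_matrix_mult_def sum_negf)

lemma matrix_mult_minus_right: "A ** (- B) = - (A ** B)"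
  for A :: "'a::ring_1 ^ 'n ^ 'm"
  by (simp add: vec_eq_iff matrix_matrix_mult_def sum_negf)

lemma norm1_minus: "norm1 (- G) = norm1 G"
  by (simp add: norm1_def)

lemma symmetric_reflexive_generalized_inverse_minus:
  "symmetric_reflexive_generalized_inverse (- B) (- G) \<longleftrightarrow>
   symmetric_reflexive_generalized_inverse B G"
  by (simp add: symmetric_reflexive_generalized_inverse_def reflexive_generalized_inverse_def
      generalized_inverse_def symmetric_matrix_def matrix_mult_minus_left matrix_mult_minus_right
      transpose_def vec_eq_iff)

text \<open>Negation is a norm-preserving bijection between the competitors for \<open>B\<close> and
  those for \<open>- B\<close>, so it carries minimizers to minimizers.\<close>

lemma min_norm1_symmetric_reflexive_generalized_inverse_minus:
  "min_norm1_symmetric_reflexive_generalized_inverse (- B) (- G) \<longleftrightarrow>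
   min_norm1_symmetric_reflexive_generalized_inverse B G"
  unfolding min_norm1_symmetric_reflexive_generalized_inverse_def
  by (metis norm1_minus symmetric_reflexive_generalized_inverse_minus minus_minus)

lemma min_norm1_outer_product:
  fixes u :: "real ^ 'n"
  assumes "u \<noteq> 0" and max: "\<And>j. \<bar>u $ j\<bar> \<le> \<bar>u $ i\<bar>"
  shows "min_norm1_symmetric_reflexive_generalized_inverse (outer_product u u)
    ((1 / (u $ i)\<^sup>2) *\<^sub>R outer_product (axis i 1) (axis i 1))"
    (is "min_norm1_symmetric_reflexive_generalized_inverse ?A ?H")
proof -
  have ui: "u $ i \<noteq> 0"
    using assms by (force simp: vec_eq_iff)
  \<comment> \<open>Absorbing the scalar into the left factor lets the product rule for outer
    products apply to \<open>?H\<close>.\<close>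
  have H: "?H = outer_product ((1 / (u $ i)\<^sup>2) *\<^sub>R axis i 1) (axis i 1)"
    by (simp add: vec_eq_iff)
  have "generalized_inverse ?A ?H" "?H ** ?A ** ?H = ?H"
    using ui unfolding H generalized_inverse_def
    by (simp_all add: outer_product_mult_outer_product inner_axis inner_axis' power2_eq_square)
  moreover have "symmetric_matrix ?H"
    by (simp add: symmetric_matrix_def transpose_def vec_eq_iff mult.commute)
  moreover have "norm1 ?H \<le> norm1 G" if "symmetric_reflexive_generalized_inverse ?A G" for G
  proof -
    \<comment> \<open>The nested conditionals let the double sum collapse one index at a time,
      leaving the only nonzero entry.\<close>
    have "\<bar>?H $ k $ j\<bar> = (if k = i then if j = i then 1 / (u $ i)\<^sup>2 else 0 else 0)" for k j
      by (simp add: axis_def)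
    moreover have "(\<Sum>j\<in>UNIV. if k = i then if j = i then c else 0 else 0) = (if k = i then c else 0)"
      for k :: 'n and c :: real
      by simp
    ultimately have "norm1 ?H = 1 / (u $ i)\<^sup>2"
      by (simp only: norm1_def) simp
    moreover have "(u v* G) \<bullet> u = 1"
      using that assms(1) by (simp add: symmetric_reflexive_generalized_inverse_def
          reflexive_generalized_inverse_def generalized_inverse_outer_product_iff)
    \<comment> \<open>Both entry bounds are \<open>\<bar>u $ i\<bar>\<close>, and their product is
      the square.\<close>
    with bilinear_form_le_norm1[OF max max] have "1 \<le> (u $ i)\<^sup>2 * norm1 G"
      by (metis abs_mult_self_eq power2_eq_square)
    then have "1 / (u $ i)\<^sup>2 \<le> norm1 G"
      using ui by (simp add: field_simps)
    ultimately show ?thesis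
      by simp
  qed
  ultimately show ?thesis
    by (simp add: min_norm1_symmetric_reflexive_generalized_inverse_def
        symmetric_reflexive_generalized_inverse_def reflexive_generalized_inverse_def)
qed

text \<open>The last two conjuncts make the reduction to \<open>u u^T\<close> precise: a symmetric
  rank-1 matrix has this form up to sign, and a sign change turns minimizers into
  minimizers.\<close>

theorem theorem3:
  fixes u :: "real ^ 'n" and A H :: "real ^ 'n ^ 'n" and i :: 'n
  assumes "u \<noteq> 0"
    and "A = outer_product u u"
    and "is_arg_max (\<lambda>j. \<bar>u $ j\<bar>) (\<lambda>j. True) i"
    and "H = (1 / (u $ i)\<^sup>2) *\<^sub>R outer_product (axis i 1) (axis i 1)"
  shows "min_norm1_symmetric_reflexive_generalized_inverse A H
    \<and> (\<forall>k. is_arg_max (\<lambda>j. \<bar>u $ j\<bar>) (\<lambda>j. True) k \<longleftrightarrow>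
           is_arg_max (\<lambda>j. \<bar>A $ j $ j\<bar>) (\<lambda>j. True) k)
    \<and> rank A = 1 \<and> symmetric_matrix A
    \<and> (\<forall>B :: real ^ 'n ^ 'n. rank B = 1 \<and> symmetric_matrix B \<longrightarrow>
           (\<exists>v. v \<noteq> 0 \<and> (B = outer_product v v \<or> - B = outer_product v v)))
    \<and> (\<forall>(B :: real ^ 'n ^ 'n) G.
           min_norm1_symmetric_reflexive_generalized_inverse (- B) (- G) \<longleftrightarrow>
           min_norm1_symmetric_reflexive_generalized_inverse B G)"
proof (intro conjI allI impI)
  show "min_norm1_symmetric_reflexive_generalized_inverse A H"
    unfolding assms(2,4)
    using assms(1,3) by (intro min_norm1_outer_product) (auto simp: is_arg_max_linorder)
  \<comment> \<open>The diagonal entries are the squares of the entries of \<open>u\<close>, and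
    squaring preserves the order of absolute values.\<close>
  have "\<bar>A $ j $ j\<bar> \<le> \<bar>A $ k $ k\<bar> \<longleftrightarrow> \<bar>u $ j\<bar> \<le> \<bar>u $ k\<bar>" for j k
    by (simp add: assms(2) abs_le_square_iff power2_eq_square)
  then show "is_arg_max (\<lambda>j. \<bar>u $ j\<bar>) (\<lambda>j. True) k \<longleftrightarrow>
      is_arg_max (\<lambda>j. \<bar>A $ j $ j\<bar>) (\<lambda>j. True) k" for k
    by (simp add: is_arg_max_linorder)
  show "rank A = 1"
    using assms(1,2) by (simp add: rank_outer_product)
  show "symmetric_matrix A"
    by (simp add: assms(2) symmetric_matrix_def transpose_def vec_eq_iff mult.commute)
  show "\<exists>v. v \<noteq> 0 \<and> (B = outer_product v v \<or> - B = outer_product v v)"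
    if "rank B = 1 \<and> symmetric_matrix B" for B :: "real ^ 'n ^ 'n"
    using that by (metis symmetric_rank_1_cases)
qed (rule min_norm1_symmetric_reflexive_generalized_inverse_minus)

end
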